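(* For all integers $m,n\ge 0$ and every $t\in\mathbb{R}$, $$\int_{-\infty}^{+\infty}H_m\!\left(y+\frac t2\right)H_n\!\left(y-\frac t2\right)e^{-y^2}\,dy=(-1)^n\sqrt{\pi}\,(\sqrt{2})^{m+n}\,H_{m,n}\!\left(\frac{t}{\sqrt 2},\frac{t}{\sqrt 2}\right).$$
   Context: The real Hermite polynomials are $H_n(x)=(-1)^n e^{x^2}\frac{d^n}{dx^n}(e^{-x^2})$, $n\ge 0$. The complex Hermite polynomials (with two indices) $H_{m,n}(z,\overline z)$, $m,n\ge 0$ integers, $z\in\mathbb{C}$ (with $\overline z$ the complex conjugate of $z$), are defined by the generating function $$\sum_{m,n=0}^{+\infty}\frac{u^m}{m!}\frac{v^n}{n!}H_{m,n}(z,\overline z)=e^{-uv+zu+\overline z v},\qquad u,v\in\mathbb{C}.$$ *)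

theory Defs
  imports "HOL-Analysis.Analysis"
begin

definition Hermite :: "nat \<Rightarrow> real \<Rightarrow> real" where
  "Hermite n x = (-1) ^ n * exp (x\<^sup>2) * (deriv ^^ n) (\<lambda>s. exp (- s\<^sup>2)) x"

text \<open>
  \<open>complex_Hermite m n z\<close> stands for \<open>H\<^sub>m\<^sub>,\<^sub>n(z, cnj z)\<close>; the second argument of the customary
  notation is determined by the first. The family is defined by its exponential generating function;
  the double series is read as an unconditionally convergent one. That exactly one family
  has this generating function is \<open>ex1_complex_Hermite\<close> below, so the description is proper.
\<close>

definition is_complex_Hermite :: "(nat \<Rightarrow> nat \<Rightarrow> complex \<Rightarrow> complex) \<Rightarrow> bool" where
  "is_complex_Hermite H \<longleftrightarrow> (\<forall>z u v :: complex.
     ((\<lambda>(m, n). u ^ m / fact m * (v ^ n / fact n) * H m n z)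
        has_sum exp (- u * v + z * u + cnj z * v)) UNIV)"

definition complex_Hermite :: "nat \<Rightarrow> nat \<Rightarrow> complex \<Rightarrow> complex" where
  "complex_Hermite = (THE H. is_complex_Hermite H)"

lemma powser_coeffs_unique:
  fixes a b :: "nat \<Rightarrow> complex"
  assumes "\<And>u. (\<lambda>n. a n * u ^ n) sums S u" "\<And>u. (\<lambda>n. b n * u ^ n) sums S u"
  shows "a = b"
proof -
  have pos: "fps_conv_radius (Abs_fps c) > 0" if "\<And>u. (\<lambda>n. c n * u ^ n) sums S u" for c
  proof -
    have "conv_radius c \<ge> norm (1::complex)"
      by (rule conv_radius_geI) (use that[of 1] in \<open>auto simp: sums_iff\<close>)
    then have "0 < conv_radius c"
      by (rule less_le_trans[rotated]) simp
    then show ?thesis by (simp add: fps_conv_radius_def)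
  qed
  have "Abs_fps a = Abs_fps b"
  proof (rule eval_fps_eqD)
    show "fps_conv_radius (Abs_fps a) > 0" "fps_conv_radius (Abs_fps b) > 0"
      by (rule pos[OF assms(1)], rule pos[OF assms(2)])
    show "eventually (\<lambda>z. eval_fps (Abs_fps a) z = eval_fps (Abs_fps b) z) (nhds 0)"
      using sums_unique[OF assms(1)] sums_unique[OF assms(2)] by (simp add: eval_fps_def)
  qed
  then have "fps_nth (Abs_fps a) n = fps_nth (Abs_fps b) n" for n by (rule arg_cong)
  then show ?thesis by (intro ext) simp
qed

lemma double_powser_coeffs_unique:
  fixes a b :: "nat \<Rightarrow> nat \<Rightarrow> complex"
  assumes a: "\<And>u v. ((\<lambda>(m, n). a m n * v ^ n * u ^ m) has_sum S u v) UNIV"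
    and b: "\<And>u v. ((\<lambda>(m, n). b m n * v ^ n * u ^ m) has_sum S u v) UNIV"
  shows "a = b"
proof -
  have inner: "(\<lambda>n. c m n * v ^ n) summable_on UNIV"
    and outer: "(\<lambda>m. infsum (\<lambda>n. c m n * v ^ n) UNIV * u ^ m) sums S u v"
    if c: "\<And>u v. ((\<lambda>(m, n). c m n * v ^ n * u ^ m) has_sum S u v) UNIV"
    for c :: "nat \<Rightarrow> nat \<Rightarrow> complex" and m u v
  proof -
    have "(\<lambda>(m, n). c m n * v ^ n * 1 ^ m) summable_on UNIV \<times> UNIV" for v
      unfolding UNIV_Times_UNIV by (rule has_sum_imp_summable[OF c])
    from summable_on_SigmaD1[OF this, of m for m]
    show s: "(\<lambda>n. c m n * v ^ n) summable_on UNIV" for m v by simp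
    have "((\<lambda>m. infsum (\<lambda>n. c m n * v ^ n) UNIV * u ^ m) has_sum S u v) UNIV"
    proof (rule has_sum_SigmaD)
      show "((\<lambda>(m, n). c m n * v ^ n * u ^ m) has_sum S u v) (UNIV \<times> UNIV)"
        using c by simp
      show "((\<lambda>y. case (x, y) of (m, n) \<Rightarrow> c m n * v ^ n * u ^ m) has_sum
          infsum (\<lambda>n. c x n * v ^ n) UNIV * u ^ x) UNIV" for x
        using has_sum_cmult_left[OF has_sum_infsum[OF s]] by simp
    qed
    then show "(\<lambda>m. infsum (\<lambda>n. c m n * v ^ n) UNIV * u ^ m) sums S u v"
      by (rule has_sum_imp_sums)
  qed
  have eq: "(\<lambda>m. infsum (\<lambda>n. a m n * v ^ n) UNIV) = (\<lambda>m. infsum (\<lambda>n. b m n * v ^ n) UNIV)" for v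
    by (rule powser_coeffs_unique[OF outer[OF a] outer[OF b]])
  have "a m = b m" for m
  proof (rule powser_coeffs_unique)
    fix v
    show "(\<lambda>n. a m n * v ^ n) sums infsum (\<lambda>n. a m n * v ^ n) UNIV"
      by (intro has_sum_imp_sums has_sum_infsum inner[OF a])
    show "(\<lambda>n. b m n * v ^ n) sums infsum (\<lambda>n. a m n * v ^ n) UNIV"
      unfolding fun_cong[OF eq] by (intro has_sum_imp_sums has_sum_infsum inner[OF b])
  qed
  then show ?thesis by (rule ext)
qed

lemma exp_has_sum: "((\<lambda>n. x ^ n / fact n) has_sum exp x) UNIV" for x :: complex
proof (rule norm_summable_imp_has_sum)
  show "summable (\<lambda>n. norm (x ^ n / fact n))"
    using summable_norm_exp[of x] by (simp add: divide_inverse scaleR_conv_of_real mult.commute)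
  show "(\<lambda>n. x ^ n / fact n) sums exp x"
    using exp_converges[of x] by (simp add: divide_inverse scaleR_conv_of_real mult.commute)
qed

lemma has_sum_times:
  fixes f g :: "_ \<Rightarrow> complex"
  assumes f: "(f has_sum a) A" and g: "(g has_sum b) B"
  shows "((\<lambda>(x, y). f x * g y) has_sum a * b) (A \<times> B)"
proof (rule has_sum_SigmaI)
  show "((\<lambda>y. case (x, y) of (x, y) \<Rightarrow> f x * g y) has_sum f x * b) B" for x
    using has_sum_cmult_right[OF g] by simp
  show "((\<lambda>x. f x * b) has_sum a * b) A"
    using has_sum_cmult_left[OF f] .
  have fa: "(\<lambda>x. norm (f x)) summable_on A" and ga: "(\<lambda>y. norm (g y)) summable_on B"
    using has_sum_imp_summable[OF f] has_sum_imp_summable[OF g]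
    unfolding summable_on_iff_abs_summable_on_complex .
  have "(\<lambda>(x, y). norm (f x) * norm (g y)) summable_on A \<times> B"
  proof (rule summable_on_SigmaI)
    show "((\<lambda>y. case (x, y) of (x, y) \<Rightarrow> norm (f x) * norm (g y)) has_sum
        norm (f x) * infsum (\<lambda>y. norm (g y)) B) B" for x
      using has_sum_cmult_right[OF has_sum_infsum[OF ga]] by simp
    show "(\<lambda>x. norm (f x) * infsum (\<lambda>y. norm (g y)) B) summable_on A"
      using fa by (rule summable_on_cmult_left)
  qed auto
  then have "(\<lambda>p. norm (case p of (x, y) \<Rightarrow> f x * g y)) summable_on A \<times> B"
    by (simp add: case_prod_unfold norm_mult)
  then show "(\<lambda>(x, y). f x * g y) summable_on A \<times> B"
    by (rule abs_summable_summable)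
qed

lemma is_complex_Hermite_explicit:
  "is_complex_Hermite (\<lambda>m n z. \<Sum>k\<le>min m n.
     (-1) ^ k * fact k * of_nat (m choose k) * of_nat (n choose k) * z ^ (m - k) * cnj z ^ (n - k))"
  unfolding is_complex_Hermite_def
proof (intro allI)
  fix z u v :: complex
  define t where "t = (\<lambda>(k, i, j). (- u * v) ^ k / fact k *
    ((z * u) ^ i / fact i * ((cnj z * v) ^ j / fact j)))"
  define D where "D = Sigma UNIV (\<lambda>(m::nat, n::nat). {..min m n})"
  have "(t has_sum exp (- u * v) * (exp (z * u) * exp (cnj z * v))) UNIV"
    using has_sum_times[OF exp_has_sum[of "- u * v"]
        has_sum_times[OF exp_has_sum[of "z * u"] exp_has_sum[of "cnj z * v"]]]
    by (simp add: t_def case_prod_unfold)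
  then have "(t has_sum exp (- u * v + z * u + cnj z * v)) UNIV"
    by (simp add: algebra_simps flip: exp_add)
  moreover have "((\<lambda>((m, n), k). t (k, m - k, n - k)) has_sum S) D \<longleftrightarrow> (t has_sum S) UNIV" for S
    by (rule has_sum_reindex_bij_witness[where i = "\<lambda>(k, i, j). ((i + k, j + k), k)"
          and j = "\<lambda>((m, n), k). (k, m - k, n - k)"]) (auto simp: D_def)
  ultimately have S: "((\<lambda>((m, n), k). t (k, m - k, n - k)) has_sum
      exp (- u * v + z * u + cnj z * v)) D" by blast
  have *: "t (k, m - k, n - k) = u ^ m / fact m * (v ^ n / fact n) *
      ((-1) ^ k * fact k * of_nat (m choose k) * of_nat (n choose k) * z ^ (m - k) * cnj z ^ (n - k))"
    if "k \<le> m" "k \<le> n" for m n k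
  proof -
    have "u ^ m = u ^ k * u ^ (m - k)" "v ^ n = v ^ k * v ^ (n - k)"
      using that by (metis le_add_diff_inverse power_add)+
    moreover have "(- u * v) ^ k = (-1) ^ k * u ^ k * v ^ k"
      by (metis mult_minus1 power_mult_distrib)
    moreover have "of_nat (m choose k) = (fact m / (fact k * fact (m - k)) :: complex)"
      "of_nat (n choose k) = (fact n / (fact k * fact (n - k)) :: complex)"
      using that by (simp_all add: binomial_fact)
    ultimately show ?thesis
      unfolding t_def prod.case power_mult_distrib[of z u] power_mult_distrib[of "cnj z" v]
      by (simp only:) (simp add: divide_simps)
  qed
  show "((\<lambda>(m, n). u ^ m / fact m * (v ^ n / fact n) * (\<Sum>k\<le>min m n.
      (-1) ^ k * fact k * of_nat (m choose k) * of_nat (n choose k) * z ^ (m - k) * cnj z ^ (n - k)))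
      has_sum exp (- u * v + z * u + cnj z * v)) UNIV"
  proof (rule has_sum_SigmaD[OF S[unfolded D_def]])
    fix x :: "nat \<times> nat"
    obtain m n where x: "x = (m, n)" by force
    show "((\<lambda>k. (\<lambda>((m, n), k). t (k, m - k, n - k)) (x, k)) has_sum
      (case x of (m, n) \<Rightarrow> u ^ m / fact m * (v ^ n / fact n) * (\<Sum>k\<le>min m n.
      (-1) ^ k * fact k * of_nat (m choose k) * of_nat (n choose k) * z ^ (m - k) * cnj z ^ (n - k))))
      (case x of (m, n) \<Rightarrow> {..min m n})"
      unfolding x prod.case sum_distrib_left
      by (rule has_sum_finiteI) (auto intro!: sum.cong simp: *)
  qed
qed

lemma is_complex_Hermite_unique:
  assumes "is_complex_Hermite H" "is_complex_Hermite K"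
  shows "H = K"
proof -
  have gen: "((\<lambda>(m, n). G m n z / (fact m * fact n) * v ^ n * u ^ m) has_sum
      exp (- u * v + z * u + cnj z * v)) UNIV" if "is_complex_Hermite G" for G z u v
  proof -
    have "((\<lambda>(m, n). u ^ m / fact m * (v ^ n / fact n) * G m n z) has_sum
        exp (- u * v + z * u + cnj z * v)) UNIV"
      using that unfolding is_complex_Hermite_def by blast
    then show ?thesis
      by (rule has_sum_cong[THEN iffD1, rotated]) (auto simp: field_simps)
  qed
  have "(\<lambda>m n. H m n z / (fact m * fact n)) = (\<lambda>m n. K m n z / (fact m * fact n))" for z
    by (rule double_powser_coeffs_unique[OF gen[OF assms(1)] gen[OF assms(2)]])
  then show ?thesis by (auto simp: fun_eq_iff)
qed

lemma ex1_complex_Hermite: "\<exists>!H. is_complex_Hermite H"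
  using is_complex_Hermite_explicit is_complex_Hermite_unique by blast

lemma is_complex_Hermite_complex_Hermite: "is_complex_Hermite complex_Hermite"
  unfolding complex_Hermite_def by (rule theI'[OF ex1_complex_Hermite])

end

theory Submission
  imports Defs "HOL-Probability.Distributions" "HOL-Real_Asymp.Real_Asymp"
begin

text \<open>
  Both sides satisfy the same recurrence \<open>F (m + 1) n = t F m n + 2n F m (n - 1)\<close> and have the same
  values at \<open>m = 0\<close>. For the integral this is an integration by parts against the Gaussian weight,
  combined with \<open>H\<^sub>m\<^sub>+\<^sub>1 = 2x H\<^sub>m - H\<^sub>m'\<close> and \<open>H\<^sub>n' = 2n H\<^sub>n\<^sub>-\<^sub>1\<close>; for the complex Hermite polynomials it
  is Pascal's rule in their explicit form.
\<close>

section \<open>Hermite polynomials\<close>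

text \<open>Formal polynomials make the later steps algebra with \<open>pderiv\<close>. The
  recursion is minus the map p -> p' - 2xp by which differentiation acts on the polynomial factor of
  p exp(-x^2).\<close>

fun hermite_poly :: "nat \<Rightarrow> real poly" where
  "hermite_poly 0 = 1"
| "hermite_poly (Suc n) = [:0, 2:] * hermite_poly n - pderiv (hermite_poly n)"

lemma has_field_derivative_poly_gauss:
  "((\<lambda>x. poly p x * exp (- x\<^sup>2)) has_field_derivative
     poly (pderiv p - [:0, 2:] * p) x * exp (- x\<^sup>2)) (at x)" for x :: real
  by (auto intro!: derivative_eq_intros simp: algebra_simps)

lemma funpow_deriv_gauss:
  "(deriv ^^ n) (\<lambda>s::real. exp (- s\<^sup>2)) = (\<lambda>x. (-1) ^ n * (poly (hermite_poly n) x * exp (- x\<^sup>2)))"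
proof (induction n)
  case (Suc n)
  have "deriv (\<lambda>x. (-1) ^ n * (poly (hermite_poly n) x * exp (- x\<^sup>2))) x =
      (-1) ^ n * (poly (pderiv (hermite_poly n) - [:0, 2:] * hermite_poly n) x * exp (- x\<^sup>2))" for x
    by (intro DERIV_imp_deriv DERIV_cmult has_field_derivative_poly_gauss)
  then show ?case
    by (simp add: Suc.IH fun_eq_iff algebra_simps)
qed simp

lemma Hermite_eq_poly: "Hermite n x = poly (hermite_poly n) x"
proof -
  have "(-1) ^ n * (-1) ^ n = (1::real)" "exp (x\<^sup>2) * exp (- x\<^sup>2) = 1"
    by (simp_all flip: power_mult_distrib exp_add)
  then show ?thesis
    by (simp add: Hermite_def funpow_deriv_gauss mult_ac)
qed

text \<open>Differentiating the recursion leaves 2 H_n plus the map q -> 2xq - q' applied to H_n'.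
  By induction H_n' = 2n H_(n-1), and that map sends H_(n-1) to H_n, so the total is 2(n + 1)
  H_n.\<close>

lemma pderiv_hermite_poly:
  "pderiv (hermite_poly n) = smult (2 * of_nat n) (hermite_poly (n - 1))"
proof (induction n)
  case (Suc n)
  have X: "pderiv [:0, 2::real:] = 2"
    by (simp add: pderiv_pCons numeral_poly)
  have factor: "[:0, 2:] * smult c q - pderiv (smult c q) = smult c ([:0, 2:] * q - pderiv q)"
    for c and q :: "real poly"
    by (simp only: pderiv_smult smult_diff_right mult_smult_right)
  have "pderiv (hermite_poly (Suc n)) =
      2 * hermite_poly n + ([:0, 2:] * pderiv (hermite_poly n) - pderiv (pderiv (hermite_poly n)))"
    unfolding hermite_poly.simps pderiv_diff pderiv_mult X by (simp only: algebra_simps)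
  also have "[:0, 2:] * pderiv (hermite_poly n) - pderiv (pderiv (hermite_poly n)) =
      smult (2 * of_nat n) (hermite_poly n)"
    unfolding Suc.IH by (cases n) (simp_all only: factor diff_Suc_1 hermite_poly.simps, simp)
  finally show ?case
    by (simp add: numeral_poly smult_add_left algebra_simps)
qed simp

section \<open>Integration of polynomials against the Gaussian weight\<close>

text \<open>The standard deviation 1/sqrt 2 matches the weight exp(-x^2), so integrability and total
  mass follow from facts on the normal distribution.\<close>

lemma normal_density_half_variance:
  "normal_density 0 (1 / sqrt 2) x = exp (- x\<^sup>2) / sqrt pi"
  by (simp add: normal_density_def power_divide)

lemma integrable_poly_gauss: "integrable lborel (\<lambda>x::real. poly p x * exp (- x\<^sup>2))"
proof -
  have "integrable lborel (\<lambda>x::real. x ^ k * exp (- x\<^sup>2))" for k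
    using integrable_mult_right[OF integrable_normal_moment[of "1 / sqrt 2" 0 k], of "sqrt pi"]
    by (simp add: normal_density_half_variance mult.commute)
  then have "integrable lborel (\<lambda>x::real. \<Sum>i\<le>degree p. coeff p i * (x ^ i * exp (- x\<^sup>2)))"
    by (intro Bochner_Integration.integrable_sum integrable_mult_right) auto
  then show ?thesis
    by (simp add: poly_altdef sum_distrib_right mult.assoc)
qed

text \<open>Taking a polynomial as argument makes this functional linear without integrability side
  conditions.\<close>

definition gauss_integral :: "real poly \<Rightarrow> real" where
  "gauss_integral p = (LINT x|lborel. poly p x * exp (- x\<^sup>2))"

lemma gauss_integral_add: "gauss_integral (p + q) = gauss_integral p + gauss_integral q"
  unfolding gauss_integral_def
  by (subst Bochner_Integration.integral_add[symmetric])
     (simp_all add: integrable_poly_gauss distrib_right)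

lemma gauss_integral_smult: "gauss_integral (smult c p) = c * gauss_integral p"
  by (simp add: gauss_integral_def mult.assoc)

lemma gauss_integral_diff: "gauss_integral (p - q) = gauss_integral p - gauss_integral q"
  using gauss_integral_add[of "p - q" q] by simp

lemma gauss_integral_one: "gauss_integral 1 = sqrt pi"
  using integral_normal_density[of "1 / sqrt 2" 0]
  by (simp add: gauss_integral_def normal_density_half_variance)

lemma tendsto_poly_gauss:
  fixes p :: "real poly"
  shows "((\<lambda>x. poly p x * exp (- x\<^sup>2)) \<longlongrightarrow> 0) at_top"
    and "((\<lambda>x. poly p x * exp (- x\<^sup>2)) \<longlongrightarrow> 0) at_bot"
proof -
  have top: "((\<lambda>x::real. x ^ k * exp (- x\<^sup>2)) \<longlongrightarrow> 0) at_top" for k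
  proof -
    have "((\<lambda>x::real. exp (x - x\<^sup>2)) \<longlongrightarrow> 0) at_top"
      by real_asymp
    \<comment> \<open>Split x^k exp(-x^2) as (x^k / exp x) * exp(x - x^2); both factors tend to
      0.\<close>
    from tendsto_mult[OF tendsto_power_div_exp_0[of k] this] show ?thesis
      by (simp add: exp_diff exp_minus field_simps)
  qed
  have bot: "((\<lambda>x::real. x ^ k * exp (- x\<^sup>2)) \<longlongrightarrow> 0) at_bot" for k
  proof -
    have "(- x) ^ k * exp (- (- x)\<^sup>2) = (-1) ^ k * (x ^ k * exp (- x\<^sup>2))" for x :: real
      by (simp add: power_minus[of x k])
    then show ?thesis
      unfolding filterlim_at_bot_mirror by (simp only: tendsto_mult_right_zero[OF top])
  qed
  show "((\<lambda>x. poly p x * exp (- x\<^sup>2)) \<longlongrightarrow> 0) at_top"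
    unfolding poly_altdef sum_distrib_right mult.assoc
    by (intro tendsto_null_sum tendsto_mult_right_zero top)
  show "((\<lambda>x. poly p x * exp (- x\<^sup>2)) \<longlongrightarrow> 0) at_bot"
    unfolding poly_altdef sum_distrib_right mult.assoc
    by (intro tendsto_null_sum tendsto_mult_right_zero bot)
qed

text \<open>The function (p' - 2xp) exp(-x^2) has the antiderivative p exp(-x^2), which vanishes at
  both infinities, so its integral is 0.\<close>

lemma gauss_integral_by_parts: "gauss_integral ([:0, 2:] * p) = gauss_integral (pderiv p)"
proof -
  define f where "f = (\<lambda>x. poly (pderiv p - [:0, 2:] * p) x * exp (- x\<^sup>2))"
  have "(LBINT x=-\<infinity>..\<infinity>. f x) = 0 - 0"
  proof (rule interval_integral_FTC_integrable)
    show "((\<lambda>x. poly p x * exp (- x\<^sup>2)) has_vector_derivative f x) (at x)" for x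
      using has_field_derivative_poly_gauss[of p x]
      by (simp add: f_def has_real_derivative_iff_has_vector_derivative)
    show "isCont f x" for x
      unfolding f_def by (intro continuous_intros)
    show "set_integrable lborel (einterval (-\<infinity>) \<infinity>) f"
      by (simp add: f_def set_integrable_def integrable_poly_gauss del: poly_diff poly_mult)
    show "(((\<lambda>x. poly p x * exp (- x\<^sup>2)) \<circ> real_of_ereal) \<longlongrightarrow> 0) (at_right (-\<infinity>))"
      by (simp add: ereal_tendsto_simps1 tendsto_poly_gauss)
    show "(((\<lambda>x. poly p x * exp (- x\<^sup>2)) \<circ> real_of_ereal) \<longlongrightarrow> 0) (at_left \<infinity>)"
      by (simp add: ereal_tendsto_simps1 tendsto_poly_gauss)
  qed simp
  then have "gauss_integral (pderiv p - [:0, 2:] * p) = 0"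
    by (simp add: f_def gauss_integral_def interval_lebesgue_integral_def set_lebesgue_integral_def)
  then show ?thesis
    by (simp only: gauss_integral_diff)
qed

section \<open>Products of shifted Hermite polynomials\<close>

definition shifted_hermite :: "real \<Rightarrow> nat \<Rightarrow> real poly" where
  "shifted_hermite c n = pcompose (hermite_poly n) [:c, 1:]"

lemma poly_shifted_hermite: "poly (shifted_hermite c n) x = Hermite n (x + c)"
  by (simp add: shifted_hermite_def poly_pcompose Hermite_eq_poly add.commute)

lemma shifted_hermite_0: "shifted_hermite c 0 = 1"
  by (simp add: shifted_hermite_def pcompose_1)

lemma pderiv_shifted_hermite:
  "pderiv (shifted_hermite c n) = smult (2 * of_nat n) (shifted_hermite c (n - 1))"
  by (simp add: shifted_hermite_def pderiv_pcompose pderiv_hermite_poly pcompose_smult pderiv_pCons)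

text \<open>The factor 2(x + c) is split into 2x, to be removed by integration by parts, and the
  constant 2c.\<close>

lemma shifted_hermite_Suc:
  "shifted_hermite c (Suc n) = [:0, 2:] * shifted_hermite c n + smult (2 * c) (shifted_hermite c n)
     - pderiv (shifted_hermite c n)"
proof -
  have "pcompose [:0, 2:] [:c, 1:] = [:0, 2:] + [:2 * c:]"
    by (simp add: pcompose_pCons)
  moreover have "([:0, 2:] + [:2 * c:]) * q = [:0, 2:] * q + smult (2 * c) q" for q
    unfolding distrib_right by simp
  ultimately show ?thesis
    by (simp only: shifted_hermite_def hermite_poly.simps pcompose_diff pcompose_mult pderiv_pcompose)
      (simp add: pderiv_pCons)
qed

text \<open>Integrating 2xab by parts gives a'b + ab'. The term a'b cancels against the derivative
  in the recursion for a, and ab' lowers the index of b. For \<open>n = 0\<close> the factor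
  \<open>of_nat n\<close> kills the term with \<open>n - 1\<close>.\<close>

lemma gauss_integral_shifted_hermite_Suc:
  "gauss_integral (shifted_hermite c (Suc m) * shifted_hermite d n) =
     2 * c * gauss_integral (shifted_hermite c m * shifted_hermite d n)
     + 2 * of_nat n * gauss_integral (shifted_hermite c m * shifted_hermite d (n - 1))"
proof -
  let ?a = "shifted_hermite c m" and ?b = "shifted_hermite d n"
  have "shifted_hermite c (Suc m) * ?b =
      [:0, 2:] * (?a * ?b) + smult (2 * c) (?a * ?b) - pderiv ?a * ?b"
    unfolding shifted_hermite_Suc ring_distribs left_diff_distrib mult_smult_left mult.assoc ..
  moreover have "pderiv (?a * ?b) = pderiv ?a * ?b
      + smult (2 * of_nat n) (?a * shifted_hermite d (n - 1))"
    by (simp add: pderiv_mult pderiv_shifted_hermite algebra_simps)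
  ultimately show ?thesis
    by (simp only: gauss_integral_diff gauss_integral_add gauss_integral_by_parts gauss_integral_smult)
qed

section \<open>Complex Hermite polynomials\<close>

lemma complex_Hermite_explicit:
  "complex_Hermite m n z = (\<Sum>k\<le>m.
     (-1) ^ k * fact k * of_nat (m choose k) * of_nat (n choose k) * z ^ (m - k) * cnj z ^ (n - k))"
proof -
  have "complex_Hermite m n z = (\<Sum>k\<le>min m n.
     (-1) ^ k * fact k * of_nat (m choose k) * of_nat (n choose k) * z ^ (m - k) * cnj z ^ (n - k))"
    by (rule is_complex_Hermite_unique[OF is_complex_Hermite_complex_Hermite is_complex_Hermite_explicit,
          THEN fun_cong, THEN fun_cong, THEN fun_cong])
  then show ?thesis
    \<comment> \<open>Terms with k > n vanish because \<open>n choose k\<close> is 0; a bound free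
      of n suits the recurrence in m.\<close>
    by (simp only:) (rule sum.mono_neutral_left, auto)
qed

lemma complex_Hermite_0: "complex_Hermite 0 n z = cnj z ^ n"
  by (simp add: complex_Hermite_explicit)

lemma complex_Hermite_Suc:
  "complex_Hermite (Suc m) n z = z * complex_Hermite m n z - of_nat n * complex_Hermite m (n - 1) z"
proof -
  \<comment> \<open>The binomial coefficient is a separate argument \<open>c\<close>, in which
    \<open>T\<close> is additive, so Pascal's rule splits each term in two.\<close>
  define T where "T = (\<lambda>c k. (-1) ^ k * fact k * of_nat c * of_nat (n choose k)
    * z ^ (Suc m - k) * cnj z ^ (n - k))"
  have "complex_Hermite (Suc m) n z = (\<Sum>k\<le>Suc m. T (Suc m choose k) k)"
    by (simp only: complex_Hermite_explicit T_def)
  also have "\<dots> = T 1 0 + (\<Sum>k\<le>m. T (m choose Suc k) (Suc k) + T (m choose k) (Suc k))"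
    unfolding sum.atMost_Suc_shift by (simp add: T_def algebra_simps)
  also have "\<dots> = (\<Sum>k\<le>Suc m. T (m choose k) k) + (\<Sum>k\<le>m. T (m choose k) (Suc k))"
    unfolding sum.atMost_Suc_shift by (simp add: sum.distrib)
  also have "(\<Sum>k\<le>Suc m. T (m choose k) k) = (\<Sum>k\<le>m. T (m choose k) k)"
    by (simp add: T_def)
  also have "\<dots> = z * complex_Hermite m n z"
    unfolding complex_Hermite_explicit sum_distrib_left
    by (intro sum.cong) (auto simp: T_def Suc_diff_le)
  also have "(\<Sum>k\<le>m. T (m choose k) (Suc k)) = - (of_nat n * complex_Hermite m (n - 1) z)"
    unfolding complex_Hermite_explicit sum_distrib_left sum_negf[symmetric]
  proof (intro sum.cong refl)
    fix k
    \<comment> \<open>Absorption: the factor k + 1 comes from \<open>fact (Suc k)\<close>, and the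
      shifted power of -1 supplies the minus sign.\<close>
    have "Suc k * (n choose Suc k) = n * ((n - 1) choose k)"
      by (cases n) (simp_all only: Suc_times_binomial binomial_0_Suc diff_Suc_1 mult_0_right mult_0)
    then have *: "(1 + of_nat k) * of_nat (n choose Suc k) = of_nat n * (of_nat ((n - 1) choose k) :: complex)"
      by (metis of_nat_Suc of_nat_mult)
    have "T (m choose k) (Suc k) = - ((-1) ^ k * fact k * of_nat (m choose k)
        * ((1 + of_nat k) * of_nat (n choose Suc k)) * z ^ (m - k) * cnj z ^ (n - Suc k))"
      by (simp add: T_def algebra_simps)
    then show "T (m choose k) (Suc k) = - (of_nat n * ((-1) ^ k * fact k * of_nat (m choose k)
        * of_nat ((n - 1) choose k) * z ^ (m - k) * cnj z ^ (n - 1 - k)))"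
      by (simp add: *)
  qed
  finally show ?thesis by simp
qed

lemma gauss_integral_eq_complex_Hermite:
  "complex_of_real (gauss_integral (shifted_hermite (t / 2) m * shifted_hermite (- t / 2) n)) =
     (-1) ^ n * complex_of_real (sqrt pi) * complex_of_real (sqrt 2) ^ (m + n) *
     complex_Hermite m n (complex_of_real (t / sqrt 2))"
proof (induction m arbitrary: n)
  case 0
  \<comment> \<open>Here the second polynomial is the constant 1, so each step of the recurrence
    only multiplies by 2c.\<close>
  have "gauss_integral (shifted_hermite c n) = (2 * c) ^ n * sqrt pi" for c
    by (induction n)
      (use gauss_integral_shifted_hermite_Suc[of c _ 0 0] in
        \<open>simp_all add: shifted_hermite_0 gauss_integral_one\<close>)
  moreover have "- t = - 1 * sqrt 2 * (t / sqrt 2)"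
    by simp
  ultimately have "gauss_integral (shifted_hermite (- t / 2) n) =
      (-1) ^ n * sqrt 2 ^ n * (t / sqrt 2) ^ n * sqrt pi"
    by (metis power_mult_distrib nonzero_mult_div_cancel_left times_divide_eq_right zero_neq_numeral)
  then show ?case
    by (simp add: shifted_hermite_0 complex_Hermite_0 mult_ac del: times_divide_eq_right)
next
  case (Suc m)
  define z s where "z = complex_of_real (t / sqrt 2)" and "s = complex_of_real (sqrt 2)"
  have t: "complex_of_real t = s * z" and s: "s * s = 2"
    unfolding z_def s_def of_real_mult[symmetric] by simp_all
  let ?J = "\<lambda>m n. (-1) ^ n * complex_of_real (sqrt pi) * s ^ (m + n) * complex_Hermite m n z"
  have "complex_of_real (gauss_integral (shifted_hermite (t / 2) (Suc m) * shifted_hermite (- t / 2) n))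
      = complex_of_real t * ?J m n + 2 * of_nat n * ?J m (n - 1)"
    by (simp only: gauss_integral_shifted_hermite_Suc of_real_add of_real_mult Suc.IH z_def s_def) simp
  also have "\<dots> = ?J (Suc m) n"
    \<comment> \<open>Passing from n - 1 to n flips the sign of (-1)^n, which matches the minus in
      the recurrence; the factor 2 = s * s restores the power of s.\<close>
    unfolding t s[symmetric] complex_Hermite_Suc by (cases n) (simp_all add: algebra_simps)
  finally show ?case
    by (simp only: z_def s_def)
qed

theorem corollary4p3:
  fixes m n :: nat and t :: real
  shows "integrable lborel (\<lambda>y::real. Hermite m (y + t / 2) * Hermite n (y - t / 2) * exp (- y\<^sup>2)) \<and>
    complex_of_real (LINT y|lborel. Hermite m (y + t / 2) * Hermite n (y - t / 2) * exp (- y\<^sup>2)) =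
      (-1) ^ n * complex_of_real (sqrt pi) * complex_of_real (sqrt 2) ^ (m + n) *
      complex_Hermite m n (complex_of_real (t / sqrt 2))"
proof -
  let ?p = "shifted_hermite (t / 2) m * shifted_hermite (- t / 2) n"
  have "(\<lambda>y. Hermite m (y + t / 2) * Hermite n (y - t / 2) * exp (- y\<^sup>2)) =
      (\<lambda>y. poly ?p y * exp (- y\<^sup>2))"
    by (simp add: poly_shifted_hermite)
  then show ?thesis
    using integrable_poly_gauss[of ?p] gauss_integral_eq_complex_Hermite[of t m n]
    by (simp only: gauss_integral_def)
qed

end
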